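(* Let $T\subseteq\mathbb{R}^d$ be either one of the $2^d$ standard closed orthants of $\mathbb{R}^d$ or $\mathbb{R}^d$ itself, and let $X=\{X_t\}_{t\in T}$ be a real-valued random field with continuous trajectories. For $b\in(0,\infty)$ let $$\mathbf{c}(b):=-\limsup_{z\to\infty}z^{-b}\sup_{t\in T}\log\mathrm{P}\{X_t>z\}.$$ Suppose that there exists $b\in(0,\infty)$ such that $\mathbf{c}(b)>0$ and, for all $\gamma\in(0,d)$, $$\sup_{w\in T}\mathrm{P}\left\{\sup_{t\in Q(w,1)\cap T}X_t>\left(\frac{\gamma}{\mathbf{c}(b)}\log s\right)^{1/b}\right\}\le s^{-\gamma+o(1)}\qquad\text{as }s\to\infty,$$ where $Q(w,1):=[w_1,w_1+1)\times\cdots\times[w_d,w_d+1)$. Then $$\limsup_{|t|\to\infty}\frac{X_t}{(\log|t|)^{1/b}}\le\left(\frac{d}{\mathbf{c}(b)}\right)^{1/b}\qquad\text{a.s.}$$ Furthermore, for all $\gamma\in(0,d)$, $$\operatorname{Dim}_{\rm H}\left\{t\in T:\ |t|>e^e,\ X_t\ge\left(\frac{\gamma}{\mathbf{c}(b)}\log|t|\right)^{1/b}\right\}\le d-\gamma\qquad\text{a.s.}$$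
   Context: $|t|:=\max_{1\le i\le d}|t_i|$ is the $\ell^\infty$-norm. Macroscopic (Barlow–Taylor) Hausdorff dimension: in $\mathbb{R}^d$ let $\mathcal{V}_n:=[-e^n,e^n)^d$ for $n\ge0$, $\mathcal{S}_0:=\mathcal{V}_0$, $\mathcal{S}_{n+1}:=\mathcal{V}_{n+1}\setminus\mathcal{V}_n$. An upright box is a set $Q(x,r)=[x_1,x_1+r)\times\cdots\times[x_d,x_d+r)$, $x\in\mathbb{R}^d$, $r>0$; its side is $r$. For $E\subseteq\mathbb{R}^d$, $\rho>0$, let $\nu^n_\rho(E):=\inf\sum_{i=1}^m(\mathrm{side}(Q_i)/e^n)^\rho$, the infimum over all finite covers of $E\cap\mathcal{S}_n$ by upright boxes $Q_1,\dots,Q_m$ of side $\ge1$. Then $\operatorname{Dim}_{\rm H}E:=\inf\{\rho>0:\sum_{n=1}^\infty\nu^n_\rho(E)<\infty\}$.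
   Formalization: The dimension bound is stated only for c(b) < ∞; for c(b) = ∞ (with γ/c(b) = 0) it fails, e.g. for X ≡ 0, where the set {|t| > e^e} has dimension d > d − γ. The limsup bound is kept for all c(b) > 0. *)

theory Defs
  imports "HOL-Probability.Probability"
begin

definition upright_box :: "real ^ 'n \<Rightarrow> real \<Rightarrow> (real ^ 'n) set" where
  "upright_box x r = {y. \<forall>i. x $ i \<le> y $ i \<and> y $ i < x $ i + r}"

definition macro_cube :: "nat \<Rightarrow> (real ^ 'n) set" where
  "macro_cube n = {x. \<forall>i. - exp (real n) \<le> x $ i \<and> x $ i < exp (real n)}"

fun macro_shell :: "nat \<Rightarrow> (real ^ 'n) set" where
  "macro_shell 0 = macro_cube 0"
| "macro_shell (Suc n) = macro_cube (Suc n) - macro_cube n"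

text \<open>The set below is nonempty and bounded below by 0, since shells are bounded.\<close>

definition macro_content :: "real \<Rightarrow> nat \<Rightarrow> (real ^ 'n) set \<Rightarrow> real" where
  "macro_content \<rho> n E =
     Inf {(\<Sum>i<m. (r i / exp (real n)) powr \<rho>) | (m :: nat) x r.
            (\<forall>i<m. 1 \<le> r i) \<and> E \<inter> macro_shell n \<subseteq> (\<Union>i<m. upright_box (x i) (r i))}"

definition macro_Hausdorff_dim :: "(real ^ 'n) set \<Rightarrow> ereal" where
  "macro_Hausdorff_dim E =
     Inf {ereal \<rho> | \<rho>. 0 < \<rho> \<and> summable (\<lambda>n. macro_content \<rho> (Suc n) E)}"

definition closed_orthants :: "(real ^ 'n) set set" where
  "closed_orthants = {{t. \<forall>i. if i \<in> I then t $ i \<le> 0 else 0 \<le> t $ i} | I. True}"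

text \<open>Logarithm of a probability, with \<open>log 0 = -\<infinity>\<close> (whereas \<open>ln 0 = 0\<close> in the library).\<close>

definition log_prob :: "real \<Rightarrow> ereal" where
  "log_prob p = (if p = 0 then -\<infinity> else ereal (ln p))"

definition tail_rate ::
    "'a measure \<Rightarrow> (real ^ 'n) set \<Rightarrow> (real ^ 'n \<Rightarrow> 'a \<Rightarrow> real) \<Rightarrow> real \<Rightarrow> ereal" where
  "tail_rate M T X b =
     - Limsup at_top (\<lambda>z::real. ereal (z powr (- b)) *
         (SUP t\<in>T. log_prob \<P>(\<omega> in M. z < X t \<omega>)))"

end

theory Submission
  imports Defs
begin

text \<open>
  Write \<open>q = 1 / c(b)\<close> and count the unit lattice boxes meeting the shell of radius \<open>exp n\<close> on which
  the field exceeds \<open>(\<kappa> q n) powr (1 / b)\<close>. There are \<open>O(exp (d n))\<close> boxes and the tail hypothesis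
  bounds each probability by \<open>exp (- n (\<kappa> - o(1)))\<close>, so this count times \<open>exp (- a n)\<close> has
  summable expectation, hence is almost surely summable, as soon as \<open>a > d - \<kappa>\<close>. Taking \<open>a = 0\<close> and
  \<open>\<kappa> > d\<close>, only finitely many boxes exceed, which bounds the limsup. Taking \<open>a = \<rho> > d - \<gamma>\<close> and
  \<open>\<kappa> < \<gamma>\<close> close to \<open>\<gamma>\<close>, the exceeding boxes cover the set of peaks and their number times
  \<open>exp (- \<rho> n)\<close> dominates its \<open>\<rho>\<close>-content.
\<close>

section \<open>Almost sure summability\<close>

text \<open>Monotone convergence makes the expectation of the sum finite, so the sum is finite
  almost surely. This takes the place of the Borel-Cantelli lemma and also handles the weighted
  counts of the dimension bound.\<close>

lemma AE_summable_if_summable_expectation: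
  fixes f :: "nat \<Rightarrow> 'a \<Rightarrow> real"
  assumes int: "\<And>n. integrable M (f n)"
    and nonneg: "\<And>n \<omega>. 0 \<le> f n \<omega>"
    and sum: "summable (\<lambda>n. \<integral>\<omega>. f n \<omega> \<partial>M)"
  shows "AE \<omega> in M. summable (\<lambda>n. f n \<omega>)"
proof -
  have meas [measurable]: "f n \<in> borel_measurable M" for n
    using int by blast
  have "(\<integral>\<^sup>+\<omega>. (\<Sum>n. ennreal (f n \<omega>)) \<partial>M) = (\<Sum>n. \<integral>\<^sup>+\<omega>. ennreal (f n \<omega>) \<partial>M)"
    by (intro nn_integral_suminf) measurable
  also have "\<dots> = (\<Sum>n. ennreal (\<integral>\<omega>. f n \<omega> \<partial>M))"
    by (simp add: nn_integral_eq_integral[OF int] nonneg)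
  also have "\<dots> = ennreal (\<Sum>n. \<integral>\<omega>. f n \<omega> \<partial>M)"
    by (intro suminf_ennreal2 sum Bochner_Integration.integral_nonneg nonneg)
  finally have "(\<integral>\<^sup>+\<omega>. (\<Sum>n. ennreal (f n \<omega>)) \<partial>M) \<noteq> \<infinity>"
    by simp
  then have "AE \<omega> in M. (\<Sum>n. ennreal (f n \<omega>)) \<noteq> \<infinity>"
    by (intro nn_integral_PInf_AE) measurable
  then show ?thesis
    by eventually_elim (auto intro: summable_suminf_not_top nonneg)
qed

section \<open>Unit lattice boxes and exponential shells\<close>

text \<open>The lower corner of the lattice box that contains \<open>t\<close>; rounding down fits
  the half-open boxes.\<close>

definition floor_vec :: "real ^ 'n \<Rightarrow> real ^ 'n" where
  "floor_vec t = (\<chi> i. of_int \<lfloor>t $ i\<rfloor>)"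

lemma mem_upright_box_floor_vec: "t \<in> upright_box (floor_vec t) 1"
  by (simp add: upright_box_def floor_vec_def)

text \<open>Index \<open>n\<close> serves \<open>macro_shell (Suc n)\<close>. All corners for the
  enclosing cube are kept, which has the right order \<open>exp (d n)\<close>.\<close>

definition shell_lattice :: "nat \<Rightarrow> (real ^ 'n) set" where
  "shell_lattice n = (\<lambda>f. \<chi> i. of_int (f i)) `
     (PiE UNIV (\<lambda>_. {- \<lceil>exp (real (Suc n))\<rceil> .. \<lceil>exp (real (Suc n))\<rceil>}))"

lemma finite_shell_lattice [simp]: "finite (shell_lattice n)"
  unfolding shell_lattice_def by (intro finite_imageI finite_PiE) auto

lemma card_shell_lattice:
  "real (card (shell_lattice n :: (real ^ 'n) set)) \<le> 9 ^ CARD('n) * exp (real n * real CARD('n))"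
proof -
  define m where "m = \<lceil>exp (real (Suc n))\<rceil>"
  have m: "0 \<le> m" "real_of_int m \<le> exp (real (Suc n)) + 1"
    using exp_gt_zero[of "real (Suc n)"] unfolding m_def by linarith+
  have "card (shell_lattice n :: (real ^ 'n) set) \<le> card (PiE (UNIV :: 'n set) (\<lambda>_. {-m..m}))"
    unfolding shell_lattice_def m_def by (intro card_image_le finite_PiE) auto
  also have "\<dots> = nat (2 * m + 1) ^ CARD('n)"
    by (simp add: card_PiE)
  finally have "real (card (shell_lattice n :: (real ^ 'n) set)) \<le> real (nat (2 * m + 1) ^ CARD('n))"
    by (simp only: of_nat_le_iff)
  also have "\<dots> = (2 * of_int m + 1) ^ CARD('n)"
    using m(1) by simp
  \<comment> \<open>From \<open>m \<le> e * exp n + 1\<close>, \<open>e < 3\<close> and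
    \<open>1 \<le> exp n\<close>:
    \<open>2 m + 1 \<le> 6 * exp n + 3 \<le> 9 * exp n\<close>.\<close>
  also have "\<dots> \<le> (9 * exp (real n)) ^ CARD('n)"
  proof (rule power_mono)
    have "exp 1 * exp (real n) \<le> 3 * exp (real n)" "1 \<le> exp (real n)"
      using e_less_272 by auto
    moreover have "real_of_int m \<le> exp 1 * exp (real n) + 1"
      using m(2) by (simp add: exp_add)
    ultimately show "2 * real_of_int m + 1 \<le> 9 * exp (real n)"
      by linarith
  qed (use m in auto)
  also have "\<dots> = 9 ^ CARD('n) * exp (real n * real CARD('n))"
    by (simp add: power_mult_distrib mult.commute flip: exp_of_nat_mult)
  finally show ?thesis .
qed

lemma floor_vec_in_shell_lattice:
  assumes "t \<in> macro_shell (Suc n)"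
  shows "floor_vec t \<in> shell_lattice n"
proof -
  have t: "- exp (real (Suc n)) \<le> t $ i" "t $ i < exp (real (Suc n))" for i
    using assms by (auto simp: macro_cube_def)
  have "- \<lceil>exp (real (Suc n))\<rceil> \<le> \<lfloor>t $ i\<rfloor>" "\<lfloor>t $ i\<rfloor> \<le> \<lceil>exp (real (Suc n))\<rceil>" for i
    using t[of i] by linarith+
  then show ?thesis
    unfolding shell_lattice_def floor_vec_def
    by (intro image_eqI[where x = "\<lambda>i. \<lfloor>t $ i\<rfloor>"]) auto
qed

text \<open>Outside \<open>macro_cube n\<close> some coordinate has modulus at least
  \<open>exp n\<close>. Hence \<open>n\<close> bounds the logarithm of the norm from below on shell
  \<open>Suc n\<close>.\<close>

lemma exp_le_infnorm_macro_shell: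
  assumes "t \<in> macro_shell (Suc n)"
  shows "exp (real n) \<le> infnorm t"
proof -
  have "t \<notin> macro_cube n"
    using assms by simp
  then obtain i where "\<not> (- exp (real n) \<le> t $ i \<and> t $ i < exp (real n))"
    unfolding macro_cube_def by blast
  then have "exp (real n) \<le> \<bar>t $ i\<bar>"
    by linarith
  then show ?thesis
    using component_le_infnorm_cart[of t i] by linarith
qed

lemma infnorm_le_macro_cube:
  assumes "t \<in> macro_cube n"
  shows "infnorm t \<le> exp (real n)"
  unfolding infnorm_cart
proof (rule cSup_least)
  fix x assume "x \<in> {\<bar>t $ i\<bar> |i. i \<in> UNIV}"
  then obtain i where "x = \<bar>t $ i\<bar>" by auto
  then show "x \<le> exp (real n)"
    using assms by (auto simp: macro_cube_def abs_le_iff intro: less_imp_le dest: spec[of _ i])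
qed auto

text \<open>Take the least cube that contains \<open>t\<close>. The hypothesis is strict because
  \<open>macro_cube N\<close> contains points of norm exactly \<open>exp N\<close>, on its lower
  faces.\<close>

lemma macro_shell_exists:
  assumes "exp (real N) < infnorm t"
  obtains n where "N \<le> n" "t \<in> macro_shell (Suc n)"
proof -
  define m where "m = (LEAST m. t \<in> macro_cube m)"
  \<comment> \<open>Some cube contains \<open>t\<close>, since \<open>exp k\<close> exceeds
    \<open>k\<close>; so the least index is meaningful.\<close>
  obtain k :: nat where k: "infnorm t < real k"
    using reals_Archimedean2 by blast
  have "t \<in> macro_cube k"
    unfolding macro_cube_def
  proof (intro CollectI allI)
    fix i
    show "- exp (real k) \<le> t $ i \<and> t $ i < exp (real k)"
      using component_le_infnorm_cart[of t i] k exp_ge_add_one_self[of "real k"] by linarith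
  qed
  then have m: "t \<in> macro_cube m"
    unfolding m_def by (rule LeastI)
  have "N < m"
  proof (rule ccontr)
    assume "\<not> N < m"
    then have "exp (real m) \<le> exp (real N)" by simp
    then show False using infnorm_le_macro_cube[OF m] assms by linarith
  qed
  then obtain n where n: "m = Suc n" "N \<le> n"
    by (cases m) auto
  moreover have "t \<notin> macro_cube n"
    using not_less_Least[of n "\<lambda>m. t \<in> macro_cube m"] n(1) by (simp add: m_def)
  ultimately show ?thesis
    using that m by auto
qed

section \<open>Content and dimension from unit covers\<close>

text \<open>The unit boxes are one admissible cover, each of weight \<open>exp (- n \<rho>)\<close>.
  Nonnegativity rests on the cover too: a real infimum over an empty set would carry no
  information.\<close>

lemma macro_content_unit_cover:
  fixes E :: "(real ^ 'n) set"
  assumes "finite W" and "E \<inter> macro_shell n \<subseteq> (\<Union>w\<in>W. upright_box w 1)"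
  shows "0 \<le> macro_content \<rho> n E" "macro_content \<rho> n E \<le> real (card W) * exp (- real n * \<rho>)"
proof -
  let ?S = "{(\<Sum>i<m. (r i / exp (real n)) powr \<rho>) | (m :: nat) x r.
            (\<forall>i<m. 1 \<le> r i) \<and> E \<inter> macro_shell n \<subseteq> (\<Union>i<m. upright_box (x i) (r i))}"
  obtain h where h: "bij_betw h {0..<card W} W"
    using ex_bij_betw_nat_finite[OF assms(1)] by blast
  have "(\<Union>i<card W. upright_box (h i) 1) = (\<Union>w\<in>W. upright_box w 1)"
    using arg_cong[OF bij_betw_imp_surj_on[OF h], of "\<lambda>W. \<Union>w\<in>W. upright_box w 1"]
    by (simp add: lessThan_atLeast0)
  moreover have "real (card W) * exp (- real n * \<rho>) = (\<Sum>i<card W. (1 / exp (real n)) powr \<rho>)"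
    by (simp add: powr_def ln_div exp_minus)
  ultimately have mem: "real (card W) * exp (- real n * \<rho>) \<in> ?S"
    using assms(2)
    by (intro CollectI exI[of _ "card W"] exI[of _ h] exI[of _ "\<lambda>_. 1"]) simp
  have nonneg: "0 \<le> x" if "x \<in> ?S" for x
    using that by (auto intro!: sum_nonneg)
  show "0 \<le> macro_content \<rho> n E"
    unfolding macro_content_def using mem nonneg by (intro cInf_greatest) blast+
  show "macro_content \<rho> n E \<le> real (card W) * exp (- real n * \<rho>)"
    unfolding macro_content_def by (rule cInf_lower[OF mem bdd_belowI[OF nonneg]])
qed

text \<open>The exponents decrease to \<open>D\<close> along a sequence, so that almost sure
  statements for the single exponents can be intersected.\<close>

lemma macro_Hausdorff_dim_le_if_summable:
  assumes "0 \<le> D" and "\<And>k. summable (\<lambda>n. macro_content (D + 1 / real (Suc k)) (Suc n) E)"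
  shows "macro_Hausdorff_dim E \<le> ereal D"
proof (rule LIMSEQ_le_const)
  have "(\<lambda>k. D + 1 / real (Suc k)) \<longlonglongrightarrow> D + 0"
    by (intro tendsto_add tendsto_const LIMSEQ_Suc lim_1_over_n)
  then show "(\<lambda>k. ereal (D + 1 / real (Suc k))) \<longlonglongrightarrow> ereal D"
    by simp
  show "\<exists>N. \<forall>k\<ge>N. macro_Hausdorff_dim E \<le> ereal (D + 1 / real (Suc k))"
    unfolding macro_Hausdorff_dim_def
    using assms by (intro exI allI impI Inf_lower) (force simp: add_nonneg_pos)
qed

text \<open>The value \<open>q = 0\<close> is allowed: it encodes an infinite tail rate.\<close>

locale tail_bounded_field = prob_space M
  for M :: "'a measure" +
  fixes T :: "(real ^ 'n) set" and X :: "real ^ 'n \<Rightarrow> 'a \<Rightarrow> real" and b q :: real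
  assumes closed_index: "closed T"
    and floor_vec_index: "t \<in> T \<Longrightarrow> floor_vec t \<in> T"
    and field_measurable: "t \<in> T \<Longrightarrow> X t \<in> borel_measurable M"
    and field_continuous: "\<omega> \<in> space M \<Longrightarrow> continuous_on T (\<lambda>t. X t \<omega>)"
    and b_pos: "0 < b"
    and q_nonneg: "0 \<le> q"
    and tail_bound: "0 < \<gamma> \<Longrightarrow> \<gamma> < real CARD('n) \<Longrightarrow>
      \<exists>\<epsilon> \<in> o(\<lambda>_. 1). \<forall>\<^sub>F s in at_top.
        (SUP w\<in>T. prob {\<omega> \<in> space M. (SUP t \<in> upright_box w 1 \<inter> T. X t \<omega>)
            > (\<gamma> * q * ln s) powr (1 / b)}) \<le> s powr (- \<gamma> + \<epsilon> s)"
begin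

section \<open>Suprema over unit boxes\<close>

text \<open>The value is meaningful only for boxes that meet \<open>T\<close>; below, the corner or
  another point of the box always lies in \<open>T\<close>.\<close>

definition box_sup :: "real ^ 'n \<Rightarrow> 'a \<Rightarrow> real" where
  "box_sup w \<omega> = (SUP t \<in> upright_box w 1 \<inter> T. X t \<omega>)"

text \<open>The half-open box is not compact, so the bound is taken on its closure, whose
  intersection with the closed set \<open>T\<close> is compact.\<close>

lemma bdd_above_box:
  assumes "\<omega> \<in> space M"
  shows "bdd_above ((\<lambda>t. X t \<omega>) ` (upright_box w 1 \<inter> T))"
proof -
  let ?K = "cbox w (w + 1) \<inter> T"
  have "compact ?K"
    using closed_index by (intro compact_Int_closed compact_cbox)
  then have "compact ((\<lambda>t. X t \<omega>) ` ?K)"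
    using field_continuous[OF assms]
    by (intro compact_continuous_image) (auto elim: continuous_on_subset)
  then have "bdd_above ((\<lambda>t. X t \<omega>) ` ?K)"
    by (intro bounded_imp_bdd_above compact_imp_bounded)
  moreover have "upright_box w 1 \<inter> T \<subseteq> ?K"
    by (auto simp: upright_box_def mem_box_cart less_imp_le)
  ultimately show ?thesis
    by (meson bdd_above_mono image_mono)
qed

lemma le_box_sup:
  assumes "\<omega> \<in> space M" "t \<in> T"
  shows "X t \<omega> \<le> box_sup (floor_vec t) \<omega>"
  unfolding box_sup_def
  using assms mem_upright_box_floor_vec by (intro cSUP_upper bdd_above_box) auto

text \<open>By continuity the supremum exceeds \<open>a\<close> exactly when the field does at some
  point of a countable dense subset.\<close>

lemma box_sup_event:
  assumes "w \<in> T"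
  shows "{\<omega> \<in> space M. a < box_sup w \<omega>} \<in> events"
proof -
  let ?B = "upright_box w 1 \<inter> T"
  obtain D where D: "countable D" "D \<subseteq> ?B" "?B \<subseteq> closure D"
    using separable by blast
  have "w \<in> ?B"
    using assms by (simp add: upright_box_def)
  have "a < box_sup w \<omega> \<longleftrightarrow> (\<exists>t\<in>D. a < X t \<omega>)" if \<omega>: "\<omega> \<in> space M" for \<omega>
  proof -
    have "a < box_sup w \<omega> \<longleftrightarrow> (\<exists>t\<in>?B. a < X t \<omega>)"
      unfolding box_sup_def using \<open>w \<in> ?B\<close> by (intro less_cSUP_iff bdd_above_box \<omega>) auto
    moreover have "\<exists>u\<in>D. a < X u \<omega>" if t: "t \<in> ?B" "a < X t \<omega>" for t
    proof (rule ccontr)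
      assume "\<not> (\<exists>u\<in>D. a < X u \<omega>)"
      then have "X u \<omega> \<le> a" if "u \<in> D" for u
        using that by force
      \<comment> \<open>Continuity is given on \<open>T\<close> only; the closure of
        \<open>D\<close> stays in \<open>T\<close> because \<open>T\<close> is closed.\<close>
      moreover have "continuous_on (closure D) (\<lambda>t. X t \<omega>)"
        using field_continuous[OF \<omega>] D(2) closed_index
        by (elim continuous_on_subset) (simp add: closure_minimal)
      ultimately have "X t \<omega> \<le> a"
        using continuous_le_on_closure[of D "\<lambda>t. X t \<omega>" t a] D(3) t(1) by blast
      then show False using t(2) by simp
    qed
    ultimately show ?thesis using D(2) by blast
  qed
  then have "{\<omega> \<in> space M. a < box_sup w \<omega>} = (\<Union>t\<in>D. {\<omega> \<in> space M. a < X t \<omega>})"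
    by auto
  also have "\<dots> \<in> events"
  proof (rule sets.countable_UN''[OF D(1)])
    fix t assume "t \<in> D"
    then have [measurable]: "X t \<in> borel_measurable M"
      using D(2) field_measurable by blast
    show "{\<omega> \<in> space M. a < X t \<omega>} \<in> events" by measurable
  qed
  finally show ?thesis .
qed

section \<open>Tail estimates and exceedance counts\<close>

text \<open>The peak threshold with \<open>ln |t|\<close> replaced by \<open>n\<close>;
  \<open>q\<close> stands for \<open>1 / c(b)\<close>.\<close>

definition level :: "real \<Rightarrow> nat \<Rightarrow> real" where
  "level \<kappa> n = (\<kappa> * q * real n) powr (1 / b)"

text \<open>Substituting \<open>s = exp (\<theta> n)\<close> with \<open>\<theta> = \<kappa> / \<gamma>\<close> extends the tail hypothesis from
  \<open>\<gamma> < d\<close> to arbitrary \<open>\<kappa>\<close>.\<close>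

lemma prob_box_sup_eventually_le:
  assumes "0 < \<kappa>" "\<eta> < \<kappa>"
  shows "\<forall>\<^sub>F n in sequentially. \<forall>w\<in>T. prob {\<omega> \<in> space M. level \<kappa> n < box_sup w \<omega>} \<le> exp (- real n * \<eta>)"
proof -
  define \<gamma> where "\<gamma> = min \<kappa> (real CARD('n)) / 2"
  define \<theta> where "\<theta> = \<kappa> / \<gamma>"
  have \<gamma>: "0 < \<gamma>" "\<gamma> < real CARD('n)"
    using assms(1) by (auto simp: \<gamma>_def min_def)
  have \<theta>: "0 < \<theta>" "\<theta> * \<gamma> = \<kappa>"
    using assms(1) \<gamma> by (auto simp: \<theta>_def)
  obtain \<epsilon> where \<epsilon>: "\<epsilon> \<in> o(\<lambda>_. 1 :: real)" and ev: "\<forall>\<^sub>F s in at_top.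
        (SUP w\<in>T. prob {\<omega> \<in> space M. (\<gamma> * q * ln s) powr (1 / b) < box_sup w \<omega>}) \<le> s powr (- \<gamma> + \<epsilon> s)"
    using tail_bound[OF \<gamma>] unfolding box_sup_def by blast
  \<comment> \<open>The admissible error: at \<open>s = exp (\<theta> n)\<close> the bound reads
    \<open>exp (- n \<kappa> + n \<theta> \<epsilon>)\<close>, which is at most
    \<open>exp (- n \<eta>)\<close> once
    \<open>\<theta> \<epsilon> \<le> \<kappa> - \<eta>\<close>.\<close>
  have "0 < (\<kappa> - \<eta>) / \<theta>"
    using assms \<theta> by simp
  from landau_o.smallD[OF \<epsilon> this]
  have "\<forall>\<^sub>F s in at_top. \<epsilon> s \<le> (\<kappa> - \<eta>) / \<theta>"
    by eventually_elim auto
  moreover have lim: "filterlim (\<lambda>n. exp (\<theta> * real n)) at_top sequentially"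
    using \<theta>(1) by (intro filterlim_compose[OF exp_at_top] filterlim_tendsto_pos_mult_at_top[OF tendsto_const]
        filterlim_real_sequentially)
  ultimately have "\<forall>\<^sub>F n in sequentially. \<epsilon> (exp (\<theta> * real n)) \<le> (\<kappa> - \<eta>) / \<theta>"
    by (rule eventually_compose_filterlim)
  moreover have "\<forall>\<^sub>F n in sequentially.
        (SUP w\<in>T. prob {\<omega> \<in> space M. (\<gamma> * q * ln (exp (\<theta> * real n))) powr (1 / b) < box_sup w \<omega>})
          \<le> exp (\<theta> * real n) powr (- \<gamma> + \<epsilon> (exp (\<theta> * real n)))"
    by (rule eventually_compose_filterlim[OF ev lim])
  ultimately show ?thesis
  proof eventually_elim
    case (elim n)
    have lev: "(\<gamma> * q * ln (exp (\<theta> * real n))) powr (1 / b) = level \<kappa> n"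
      using \<theta>(2) by (simp add: level_def mult_ac flip: \<theta>(2))
    show ?case
    proof
      fix w assume "w \<in> T"
      then have "prob {\<omega> \<in> space M. level \<kappa> n < box_sup w \<omega>}
          \<le> (SUP w\<in>T. prob {\<omega> \<in> space M. level \<kappa> n < box_sup w \<omega>})"
        by (intro cSUP_upper bdd_aboveI2[where M = 1]) auto
      also have "\<dots> \<le> exp (\<theta> * real n) powr (- \<gamma> + \<epsilon> (exp (\<theta> * real n)))"
        using elim(2) unfolding lev .
      also have "\<dots> = exp (real n * (\<theta> * (- \<gamma> + \<epsilon> (exp (\<theta> * real n)))))"
        by (simp add: powr_def mult_ac)
      also have "\<dots> \<le> exp (- real n * \<eta>)"
      proof -
        have "\<theta> * \<epsilon> (exp (\<theta> * real n)) \<le> \<kappa> - \<eta>"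
          using elim(1) \<theta>(1) by (simp add: pos_le_divide_eq mult.commute)
        then have "\<theta> * (- \<gamma> + \<epsilon> (exp (\<theta> * real n))) \<le> - \<eta>"
          using \<theta>(2) by (simp add: algebra_simps)
        from mult_left_mono[OF this, of "real n"] show ?thesis by simp
      qed
      finally show "prob {\<omega> \<in> space M. level \<kappa> n < box_sup w \<omega>} \<le> exp (- real n * \<eta>)" .
    qed
  qed
qed

text \<open>The level has index \<open>n\<close> although the boxes serve shell
  \<open>Suc n\<close>: there \<open>ln |t|\<close> is at least \<open>n\<close>, so the level lies
  below the thresholds of all points of the shell.\<close>

definition exceedances :: "real \<Rightarrow> nat \<Rightarrow> 'a \<Rightarrow> (real ^ 'n) set" where
  "exceedances \<kappa> n \<omega> = {w \<in> shell_lattice n \<inter> T. level \<kappa> n < box_sup w \<omega>}"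

lemma finite_exceedances [simp]: "finite (exceedances \<kappa> n \<omega>)"
  by (simp add: exceedances_def)

text \<open>The box of \<open>t\<close> contains \<open>t\<close>, so its supremum is at least
  \<open>X t \<omega>\<close>. This is the passage from high points to counted boxes.\<close>

lemma floor_vec_in_exceedances:
  assumes "\<omega> \<in> space M" "t \<in> T" "t \<in> macro_shell (Suc n)" "level \<kappa> n < X t \<omega>"
  shows "floor_vec t \<in> exceedances \<kappa> n \<omega>"
  using assms le_box_sup[of \<omega> t] floor_vec_index floor_vec_in_shell_lattice
  unfolding exceedances_def by force

text \<open>The count is a finite sum of indicators, and expectation is linear.\<close>

lemma
  shows integrable_card_exceedances: "integrable M (\<lambda>\<omega>. real (card (exceedances \<kappa> n \<omega>)))" (is ?int)
    and expectation_card_exceedances: "expectation (\<lambda>\<omega>. real (card (exceedances \<kappa> n \<omega>))) =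
      (\<Sum>w\<in>shell_lattice n \<inter> T. prob {\<omega> \<in> space M. level \<kappa> n < box_sup w \<omega>})" (is ?exp)
proof -
  let ?W = "shell_lattice n \<inter> T"
  let ?A = "\<lambda>w. {\<omega> \<in> space M. level \<kappa> n < box_sup w \<omega>}"
  have eq: "real (card (exceedances \<kappa> n \<omega>)) = (\<Sum>w\<in>?W. indicator (?A w) \<omega>)" if "\<omega> \<in> space M" for \<omega>
  proof -
    have "real (card (exceedances \<kappa> n \<omega>)) = (\<Sum>w\<in>exceedances \<kappa> n \<omega>. 1)"
      by simp
    also have "\<dots> = (\<Sum>w\<in>?W. if level \<kappa> n < box_sup w \<omega> then 1 else 0)"
      unfolding exceedances_def by (rule sum.inter_filter) simp
    also have "\<dots> = (\<Sum>w\<in>?W. indicator (?A w) \<omega>)"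
      using that by (intro sum.cong) (auto simp: indicator_def)
    finally show ?thesis .
  qed
  have int: "integrable M (indicator (?A w) :: 'a \<Rightarrow> real)" if "w \<in> ?W" for w
    using that box_sup_event by (intro integrable_real_indicator) (auto simp: emeasure_eq_measure)
  then have "integrable M (\<lambda>\<omega>. \<Sum>w\<in>?W. indicator (?A w) \<omega> :: real)"
    by (intro Bochner_Integration.integrable_sum)
  then show ?int
    using eq by (subst Bochner_Integration.integrable_cong[OF refl]) auto
  have "expectation (\<lambda>\<omega>. real (card (exceedances \<kappa> n \<omega>))) = expectation (\<lambda>\<omega>. \<Sum>w\<in>?W. indicator (?A w) \<omega>)"
    using eq by (intro Bochner_Integration.integral_cong) auto
  also have "\<dots> = (\<Sum>w\<in>?W. expectation (indicator (?A w)))"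
    using int by (intro Bochner_Integration.integral_sum) auto
  also have "\<dots> = (\<Sum>w\<in>?W. prob (?A w))"
    by (intro sum.cong) (auto simp: Int_absorb2)
  finally show ?exp .
qed

text \<open>Number of boxes times probability gives an expected count of order
  \<open>exp (n (d - \<eta>))\<close> for each \<open>\<eta> < \<kappa>\<close>; the weight turns
  this into a geometric series.\<close>

lemma AE_summable_card_exceedances:
  assumes "0 < \<kappa>" "real CARD('n) - \<kappa> < a"
  shows "AE \<omega> in M. summable (\<lambda>n. real (card (exceedances \<kappa> n \<omega>)) * exp (- real n * a))"
proof (rule AE_summable_if_summable_expectation)
  let ?d = "real CARD('n)"
  \<comment> \<open>The midpoint of \<open>d - a\<close> and \<open>\<kappa>\<close>, so that
    \<open>\<eta> < \<kappa>\<close> and \<open>\<delta> = (a + \<kappa> - d) / 2\<close> is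
    positive.\<close>
  define \<eta> where "\<eta> = (\<kappa> + (?d - a)) / 2"
  define \<delta> where "\<delta> = a + \<eta> - ?d"
  have \<eta>: "\<eta> < \<kappa>" and \<delta>: "0 < \<delta>"
    using assms(2) by (auto simp: \<eta>_def \<delta>_def field_simps)
  have "\<forall>\<^sub>F n in sequentially.
    norm (expectation (\<lambda>\<omega>. real (card (exceedances \<kappa> n \<omega>)) * exp (- real n * a))) \<le> 9 ^ CARD('n) * exp (- \<delta>) ^ n"
    using prob_box_sup_eventually_le[OF assms(1) \<eta>]
  proof eventually_elim
    case (elim n)
    let ?S = "shell_lattice n \<inter> T"
    have "expectation (\<lambda>\<omega>. real (card (exceedances \<kappa> n \<omega>))) \<le> (\<Sum>w\<in>?S. exp (- real n * \<eta>))"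
      unfolding expectation_card_exceedances using elim by (intro sum_mono) auto
    also have "\<dots> = real (card ?S) * exp (- real n * \<eta>)"
      by simp
    also have "\<dots> \<le> (9 ^ CARD('n) * exp (real n * ?d)) * exp (- real n * \<eta>)"
      by (intro mult_right_mono order.trans[OF _ card_shell_lattice]) (auto intro: card_mono)
    finally have "expectation (\<lambda>\<omega>. real (card (exceedances \<kappa> n \<omega>))) * exp (- real n * a)
        \<le> (9 ^ CARD('n) * exp (real n * ?d)) * exp (- real n * \<eta>) * exp (- real n * a)"
      by (intro mult_right_mono) auto
    also have "\<dots> = 9 ^ CARD('n) * exp (real n * ?d + - real n * \<eta> + - real n * a)"
      by (simp only: exp_add mult.assoc)
    also have "real n * ?d + - real n * \<eta> + - real n * a = real n * (- \<delta>)"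
      by (simp add: \<delta>_def algebra_simps)
    also have "exp (real n * (- \<delta>)) = exp (- \<delta>) ^ n"
      by (rule exp_of_nat_mult)
    finally show ?case
      by (simp add: abs_mult)
  qed
  moreover have "summable (\<lambda>n. 9 ^ CARD('n) * exp (- \<delta>) ^ n)"
    using \<delta> by (intro summable_mult summable_geometric) simp
  ultimately show "summable (\<lambda>n. expectation (\<lambda>\<omega>. real (card (exceedances \<kappa> n \<omega>)) * exp (- real n * a)))"
    by (rule summable_comparison_test_ev)
qed (auto intro: integrable_card_exceedances)

section \<open>The almost sure growth bound\<close>

text \<open>For \<open>\<kappa> > d\<close> the weight \<open>a = 0\<close> is allowed, so the
  counts themselves are summable.\<close>

lemma AE_eventually_le_level:
  assumes "real CARD('n) < \<kappa>"
  shows "AE \<omega> in M. \<forall>\<^sub>F t in inf (filtercomap infnorm at_top) (principal T).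
    ereal (X t \<omega> / ln (infnorm t) powr (1 / b)) \<le> ereal ((\<kappa> * q) powr (1 / b))"
proof -
  have \<kappa>: "0 < \<kappa>" using assms by (rule le_less_trans[rotated]) simp
  have "AE \<omega> in M. summable (\<lambda>n. real (card (exceedances \<kappa> n \<omega>)) * exp (- real n * 0))"
    using assms \<kappa> by (intro AE_summable_card_exceedances) auto
  then show ?thesis
    using AE_space
  proof eventually_elim
    case (elim \<omega>)
    then have "(\<lambda>n. real (card (exceedances \<kappa> n \<omega>))) \<longlonglongrightarrow> 0"
      by (intro summable_LIMSEQ_zero) simp
    then have "\<forall>\<^sub>F n in sequentially. real (card (exceedances \<kappa> n \<omega>)) < 1"
      by (rule order_tendstoD) simp
    \<comment> \<open>Counts are integers, so a count below 1 is zero.\<close>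
    then obtain N where N: "\<And>n. N \<le> n \<Longrightarrow> exceedances \<kappa> n \<omega> = {}"
      unfolding eventually_sequentially by auto
    have "X t \<omega> / ln (infnorm t) powr (1 / b) \<le> (\<kappa> * q) powr (1 / b)"
      if t: "t \<in> T" "exp (real N) < infnorm t" for t
    proof -
      obtain n where n: "N \<le> n" "t \<in> macro_shell (Suc n)"
        using macro_shell_exists[OF t(2)] .
      \<comment> \<open>Makes the logarithm positive, as the final division requires.\<close>
      have "1 < infnorm t"
        using t(2) by (rule le_less_trans[rotated]) simp
      have "real n \<le> ln (infnorm t)"
        using exp_le_infnorm_macro_shell[OF n(2)] \<open>1 < infnorm t\<close> by (subst ln_ge_iff) auto
      have "\<not> level \<kappa> n < X t \<omega>"
        using floor_vec_in_exceedances[OF elim(2) t(1) n(2)] N[OF n(1)] by blast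
      then have "X t \<omega> \<le> level \<kappa> n" by simp
      also have "\<dots> \<le> (\<kappa> * q * ln (infnorm t)) powr (1 / b)"
        unfolding level_def using b_pos q_nonneg \<kappa> \<open>real n \<le> ln (infnorm t)\<close>
        by (intro powr_mono2 mult_left_mono) auto
      also have "\<dots> = (\<kappa> * q) powr (1 / b) * ln (infnorm t) powr (1 / b)"
        by (rule powr_mult)
      finally show ?thesis
        using \<open>1 < infnorm t\<close> by (subst pos_divide_le_eq) auto
    qed
    moreover have "\<forall>\<^sub>F t :: real ^ 'n in filtercomap infnorm at_top. exp (real N) < infnorm t"
      by (intro eventually_filtercomapI eventually_gt_at_top)
    ultimately show ?case
      unfolding eventually_inf_principal by (auto elim: eventually_mono)
  qed
qed

text \<open>The summability estimate requires \<open>\<kappa> > d\<close>, so \<open>d\<close> is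
  approached along a sequence, with one null set per term.\<close>

lemma AE_Limsup_le:
  "AE \<omega> in M. Limsup (inf (filtercomap infnorm at_top) (principal T))
      (\<lambda>t. ereal (X t \<omega> / ln (infnorm t) powr (1 / b))) \<le> ereal ((real CARD('n) * q) powr (1 / b))"
proof -
  let ?\<kappa> = "\<lambda>k. real CARD('n) + 1 / real (Suc k)"
  have "AE \<omega> in M. \<forall>k. \<forall>\<^sub>F t in inf (filtercomap infnorm at_top) (principal T).
    ereal (X t \<omega> / ln (infnorm t) powr (1 / b)) \<le> ereal ((?\<kappa> k * q) powr (1 / b))"
    unfolding AE_all_countable by (intro allI AE_eventually_le_level) simp
  then show ?thesis
  proof eventually_elim
    case (elim \<omega>)
    \<comment> \<open>For \<open>q = 0\<close> the base tends to 0, where the power is still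
      continuous from the right because its exponent is positive.\<close>
    have "(\<lambda>k. (?\<kappa> k * q) powr (1 / b)) \<longlonglongrightarrow> ((real CARD('n) + 0) * q) powr (1 / b)"
    proof (rule tendsto_powr2)
      show "(\<lambda>k. ?\<kappa> k * q) \<longlonglongrightarrow> (real CARD('n) + 0) * q"
        using LIMSEQ_Suc[OF lim_1_over_n] by (intro tendsto_mult tendsto_add tendsto_const)
    qed (use b_pos q_nonneg in auto)
    then have "(\<lambda>k. ereal ((?\<kappa> k * q) powr (1 / b))) \<longlonglongrightarrow> ereal ((real CARD('n) * q) powr (1 / b))"
      by simp
    then show ?case
      by (rule LIMSEQ_le_const) (use elim in \<open>blast intro: Limsup_bounded\<close>)
  qed
qed

section \<open>Dimension of the set of peaks\<close>

text \<open>With \<open>q > 0\<close>, the gap between \<open>\<kappa>\<close> and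
  \<open>\<gamma>\<close> turns the weak inequality that defines peaks into the strict one that
  defines exceedances.\<close>

lemma AE_summable_macro_content:
  assumes "0 < q" "0 < \<kappa>" "\<kappa> < \<gamma>" "real CARD('n) - \<kappa> < \<rho>" "0 < \<rho>"
  shows "AE \<omega> in M. summable (\<lambda>n. macro_content \<rho> (Suc n)
    {t \<in> T. infnorm t > exp (exp 1) \<and> X t \<omega> \<ge> (\<gamma> * q * ln (infnorm t)) powr (1 / b)})"
  using AE_summable_card_exceedances[OF assms(2,4)] AE_space
proof eventually_elim
  case (elim \<omega>)
  have \<gamma>: "0 < \<gamma>"
    using assms(2,3) by simp
  let ?E = "{t \<in> T. infnorm t > exp (exp 1) \<and> X t \<omega> \<ge> (\<gamma> * q * ln (infnorm t)) powr (1 / b)}"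
  have "\<forall>\<^sub>F n in sequentially. norm (macro_content \<rho> (Suc n) ?E)
      \<le> real (card (exceedances \<kappa> n \<omega>)) * exp (- real n * \<rho>)"
    \<comment> \<open>At \<open>n = 0\<close> both levels vanish, so the strict comparison starts at
      \<open>n = 1\<close>.\<close>
    using eventually_gt_at_top[of 0]
  proof eventually_elim
    case n: (elim n)
    have cover: "?E \<inter> macro_shell (Suc n) \<subseteq> (\<Union>w\<in>exceedances \<kappa> n \<omega>. upright_box w 1)"
    proof
      fix t assume t: "t \<in> ?E \<inter> macro_shell (Suc n)"
      then have le: "exp (real n) \<le> infnorm t"
        using exp_le_infnorm_macro_shell by blast
      then have "0 < infnorm t"
        by (rule less_le_trans[rotated]) simp
      then have "real n \<le> ln (infnorm t)"
        using le by (subst ln_ge_iff) auto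
      have "level \<kappa> n < (\<gamma> * q * real n) powr (1 / b)"
        unfolding level_def using n b_pos assms by (intro powr_less_mono2 mult_strict_right_mono) auto
      also have "\<dots> \<le> (\<gamma> * q * ln (infnorm t)) powr (1 / b)"
        using b_pos q_nonneg \<gamma> \<open>real n \<le> ln (infnorm t)\<close> by (intro powr_mono2 mult_left_mono) auto
      also have "\<dots> \<le> X t \<omega>"
        using t by simp
      finally have "floor_vec t \<in> exceedances \<kappa> n \<omega>"
        using t elim(2) by (intro floor_vec_in_exceedances) auto
      then show "t \<in> (\<Union>w\<in>exceedances \<kappa> n \<omega>. upright_box w 1)"
        using mem_upright_box_floor_vec by blast
    qed
    note content = macro_content_unit_cover[OF finite_exceedances cover, of \<rho>]
    have "norm (macro_content \<rho> (Suc n) ?E) = macro_content \<rho> (Suc n) ?E"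
      using content(1) by simp
    also note content(2)
    \<comment> \<open>Shell \<open>Suc n\<close> carries the weight
      \<open>exp (- (n + 1) \<rho>)\<close>; the shift costs nothing since
      \<open>\<rho> > 0\<close>.\<close>
    also have "real (card (exceedances \<kappa> n \<omega>)) * exp (- real (Suc n) * \<rho>)
        \<le> real (card (exceedances \<kappa> n \<omega>)) * exp (- real n * \<rho>)"
      using assms(5) by (intro mult_left_mono) (auto simp: algebra_simps)
    finally show ?case .
  qed
  then show ?case
    using elim(1) by (rule summable_comparison_test_ev)
qed

lemma AE_macro_Hausdorff_dim_le:
  assumes "0 < q" "0 < \<gamma>" "\<gamma> < real CARD('n)"
  shows "AE \<omega> in M. macro_Hausdorff_dim
    {t \<in> T. infnorm t > exp (exp 1) \<and> X t \<omega> \<ge> (\<gamma> * q * ln (infnorm t)) powr (1 / b)}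
    \<le> ereal (real CARD('n) - \<gamma>)"
proof -
  have "AE \<omega> in M. \<forall>k. summable (\<lambda>n. macro_content (real CARD('n) - \<gamma> + 1 / real (Suc k)) (Suc n)
    {t \<in> T. infnorm t > exp (exp 1) \<and> X t \<omega> \<ge> (\<gamma> * q * ln (infnorm t)) powr (1 / b)})"
    unfolding AE_all_countable
  proof
    fix k
    define \<delta> where "\<delta> = 1 / real (Suc k)"
    \<comment> \<open>Staying within \<open>\<delta> / 2\<close> of \<open>\<gamma>\<close> gives
      \<open>d - \<kappa> < d - \<gamma> + \<delta>\<close>; the maximum with
      \<open>\<gamma> / 2\<close> keeps \<open>\<kappa>\<close> positive.\<close>
    define \<kappa> where "\<kappa> = max (\<gamma> / 2) (\<gamma> - \<delta> / 2)"
    have "0 < \<delta>" by (simp add: \<delta>_def)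
    then have "0 < \<kappa>" "\<kappa> < \<gamma>" "real CARD('n) - \<kappa> < real CARD('n) - \<gamma> + \<delta>" "0 < real CARD('n) - \<gamma> + \<delta>"
      using assms(2,3) unfolding \<kappa>_def by linarith+
    then show "AE \<omega> in M. summable (\<lambda>n. macro_content (real CARD('n) - \<gamma> + 1 / real (Suc k)) (Suc n)
      {t \<in> T. infnorm t > exp (exp 1) \<and> X t \<omega> \<ge> (\<gamma> * q * ln (infnorm t)) powr (1 / b)})"
      unfolding \<delta>_def[symmetric] by (rule AE_summable_macro_content[OF assms(1)])
  qed
  then show ?thesis
    by eventually_elim (intro macro_Hausdorff_dim_le_if_summable, use assms(3) in auto)
qed

end

section \<open>Admissible index sets and conclusion\<close>

lemma closed_index_set:
  assumes "T = UNIV \<or> T \<in> closed_orthants"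
  shows "closed T"
proof -
  have "closed {t :: real ^ 'n. \<forall>i. if i \<in> I then t $ i \<le> 0 else 0 \<le> t $ i}" for I
  proof (intro closed_Collect_all)
    fix i
    show "closed {t :: real ^ 'n. if i \<in> I then t $ i \<le> 0 else 0 \<le> t $ i}"
      by (cases "i \<in> I") (auto intro!: closed_Collect_le continuous_intros)
  qed
  then show ?thesis
    using assms by (auto simp: closed_orthants_def)
qed

text \<open>Rounding down preserves both \<open>\<le> 0\<close> and \<open>\<ge> 0\<close>. The tail
  hypothesis speaks of boxes with corner in \<open>T\<close>, so corners must not leave
  \<open>T\<close>.\<close>

lemma floor_vec_index_set:
  assumes "T = UNIV \<or> T \<in> closed_orthants" "t \<in> T"
  shows "floor_vec t \<in> T"
  using assms(1)
proof
  assume "T \<in> closed_orthants"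
  then obtain I where T: "T = {t. \<forall>i. if i \<in> I then t $ i \<le> 0 else 0 \<le> t $ i}"
    by (auto simp: closed_orthants_def)
  have "if i \<in> I then floor_vec t $ i \<le> 0 else 0 \<le> floor_vec t $ i" for i
  proof -
    have "if i \<in> I then t $ i \<le> 0 else 0 \<le> t $ i"
      using assms(2) T by blast
    then show ?thesis
      by (auto simp: floor_vec_def floor_le_iff split: if_splits)
  qed
  then show ?thesis unfolding T by blast
qed simp

theorem theorem4p1:
  fixes M :: "'a measure"
    and T :: "(real ^ 'n) set"
    and X :: "real ^ 'n \<Rightarrow> 'a \<Rightarrow> real"
    and b :: real
  assumes "prob_space M"
    and "T = UNIV \<or> T \<in> closed_orthants"
    and "\<And>t. t \<in> T \<Longrightarrow> X t \<in> borel_measurable M"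
    and "\<And>\<omega>. \<omega> \<in> space M \<Longrightarrow> continuous_on T (\<lambda>t. X t \<omega>)"
    and "0 < b"
    and "0 < tail_rate M T X b"
    and "\<And>\<gamma>. 0 < \<gamma> \<Longrightarrow> \<gamma> < real CARD('n) \<Longrightarrow>
           \<exists>\<epsilon> \<in> o(\<lambda>_. 1). \<forall>\<^sub>F s in at_top.
             (SUP w\<in>T. \<P>(\<omega> in M. (SUP t \<in> upright_box w 1 \<inter> T. X t \<omega>)
                           > (real_of_ereal (ereal \<gamma> / tail_rate M T X b) * ln s) powr (1 / b)))
             \<le> s powr (- \<gamma> + \<epsilon> s)"
  shows "(AE \<omega> in M.
            Limsup (inf (filtercomap infnorm at_top) (principal T))
              (\<lambda>t. ereal (X t \<omega> / ln (infnorm t) powr (1 / b)))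
            \<le> ereal (real_of_ereal (ereal (real CARD('n)) / tail_rate M T X b) powr (1 / b)))
       \<and> (tail_rate M T X b < \<infinity> \<longrightarrow>
           (\<forall>\<gamma>. 0 < \<gamma> \<and> \<gamma> < real CARD('n) \<longrightarrow>
             (AE \<omega> in M.
               macro_Hausdorff_dim
                 {t \<in> T. infnorm t > exp (exp 1) \<and>
                    X t \<omega> \<ge> (real_of_ereal (ereal \<gamma> / tail_rate M T X b) * ln (infnorm t)) powr (1 / b)}
               \<le> ereal (real CARD('n) - \<gamma>))))"
proof -
  \<comment> \<open>An infinite rate gives \<open>q = 0\<close>, since a finite number divided by
    infinity is 0.\<close>
  define q where "q = real_of_ereal (1 / tail_rate M T X b)"
  have q: "real_of_ereal (ereal \<gamma> / tail_rate M T X b) = \<gamma> * q" for \<gamma>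
    using assms(6) unfolding q_def by (cases "tail_rate M T X b") (auto simp: one_ereal_def)
  have q_nonneg: "0 \<le> q"
    using assms(6) unfolding q_def by (cases "tail_rate M T X b") (auto simp: one_ereal_def)
  interpret prob_space M by fact
  interpret tail_bounded_field M T X b q
    using closed_index_set[OF assms(2)] floor_vec_index_set[OF assms(2)] assms(3-5,7) q_nonneg
    unfolding q by unfold_locales
  \<comment> \<open>An infinite rate would put the peak threshold at 0; the zero field then meets
    the hypotheses, yet its peaks fill \<open>T\<close> outside a cube, a set of dimension
    \<open>d\<close>.\<close>
  have "0 < q" if "tail_rate M T X b < \<infinity>"
    using assms(6) that unfolding q_def by (cases "tail_rate M T X b") (auto simp: one_ereal_def)
  then show ?thesis
    unfolding q using AE_Limsup_le AE_macro_Hausdorff_dim_le by blast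
qed

end
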